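(* Let $p,q$ be non-negative integers with $n=p+q$ positive and let $v$ be a non-zero element of $\mathbb C^n$. Then the vector spaces $$\mathcal E_1(v)=\{\phi_a:\mathrm U(p,q)\to\mathbb C\ |\ \phi_a(z)=\mathrm{trace}(v^taz^t),\ a\in\mathbb C^p_1\}$$ and $$\mathcal E_2(v)=\{\phi_a:\mathrm U(p,q)\to\mathbb C\ |\ \phi_a(z)=\mathrm{trace}(v^taz^t),\ a\in\mathbb C^q_2\}$$ are eigenfamilies on $\mathrm U(p,q)$ and their union $\mathcal B=\mathcal E_1(v)\cup\mathcal E_2(v)$ is a bi-eigenfamily.
   Context: Elements of $\mathbb C^n$ are row vectors, so $v^ta$ is the $n\times n$ matrix with entries $v_ia_j$. Notation: $\mathbb C^p_1=\{(z,w)\in\mathbb C^p\times\mathbb C^q\ |\ w=0\}$ and $\mathbb C^q_2=\{(z,w)\in\mathbb C^p\times\mathbb C^q\ |\ z=0\}$, both viewed as subspaces of $\mathbb C^n$. $\mathrm U(p,q)=\{z\in\mathrm{GL}_{p+q}(\mathbb C)\ |\ zI_{pq}z^*=I_{pq}\}$ with $I_{pq}=\begin{pmatrix}-I_p&0\\0&I_q\end{pmatrix}$. It carries its standard left-invariant Riemannian metric, induced by the scalar product $g(Z,W)=\mathrm{Re}\,\mathrm{trace}(ZW^* )$ on its Lie algebra. For complex valued functions $\phi,\psi$ on a Lie group with left-invariant Riemannian metric, the Laplacian (tension field) $\tau$ and the operator $\kappa(\phi,\psi)=g(\mathrm{grad}(\phi),\mathrm{grad}(\psi))$ ($g$ extended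 complex bilinearly) are given by $\tau(\phi)=\sum_{Z\in\mathcal B}Z^2(\phi)$ and $\kappa(\phi,\psi)=\sum_{Z\in\mathcal B}Z(\phi)Z(\psi)$, where here $\mathcal B$ is any orthonormal basis of the Lie algebra of left-invariant vector fields, $Z(\phi)(p)=\frac{d}{ds}[\phi(p\cdot\exp(sZ))]|_{s=0}$ and $Z^2(\phi)(p)=\frac{d^2}{ds^2}[\phi(p\cdot\exp(sZ))]|_{s=0}$. A set $\mathcal E$ of complex valued functions is an eigenfamily if there exist $\lambda,\mu\in\mathbb C$ with $\tau(\phi)=\lambda\phi$ and $\kappa(\phi,\psi)=\mu\phi\psi$ for all $\phi,\psi\in\mathcal E$. The union of two non-empty eigenfamilies $\mathcal E_1,\mathcal E_2$ (with possibly different constants) is a bi-eigenfamily if there exists $\mu\in\mathbb C$ with $\kappa(\phi,\psi)=\mu\phi\psi$ for all $\phi\in\mathcal E_1$, $\psi\in\mathcal E_2$. *)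

theory Defs
  imports
    "HOL-Analysis.Derivative"
    "HOL-Library.FuncSet"
    "Jordan_Normal_Form.Schur_Decomposition"
begin

definition mat_trace :: "complex mat \<Rightarrow> complex" where
  "mat_trace A = (\<Sum>i<dim_row A. A $$ (i, i))"

(* The exponential series, summed entry by entry. *)
definition mat_exp :: "complex mat \<Rightarrow> complex mat" where
  "mat_exp A = mat (dim_row A) (dim_row A) (\<lambda>(i, j). \<Sum>k. (A ^\<^sub>m k) $$ (i, j) / fact k)"

abbreviation one_param :: "complex mat \<Rightarrow> real \<Rightarrow> complex mat" where
  "one_param Z s \<equiv> mat_exp (complex_of_real s \<cdot>\<^sub>m Z)"

(* A (closed) subgroup G of the invertible n x n matrices is given by its set of elements.  A
   left-invariant vector field is identified with its value Z at the identity, an n x n matrix, whose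
   flow is right multiplication by exp(sZ).  Complex valued functions on G are functions on all
   complex matrices that are undefined outside G (as in FuncSet), and only their values on G matter. *)

definition lie_algebra :: "nat \<Rightarrow> complex mat set \<Rightarrow> complex mat set" where
  "lie_algebra n G = {Z \<in> carrier_mat n n. \<forall>s. one_param Z s \<in> G}"

definition lie_inner :: "complex mat \<Rightarrow> complex mat \<Rightarrow> real" where
  "lie_inner Z W = Re (mat_trace (Z * mat_adjoint W))"

(* Bases over the reals: the Lie algebra is only a real vector space. *)
definition orthonormal_basis :: "nat \<Rightarrow> complex mat set \<Rightarrow> complex mat set \<Rightarrow> bool" where
  "orthonormal_basis n G B \<longleftrightarrow>
     finite B \<and> B \<subseteq> lie_algebra n G \<and>
     (\<forall>Z\<in>B. \<forall>W\<in>B. lie_inner Z W = (if Z = W then 1 else 0)) \<and>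
     (\<forall>X\<in>lie_algebra n G. \<exists>c :: complex mat \<Rightarrow> real. \<forall>i<n. \<forall>j<n.
        X $$ (i, j) = (\<Sum>Z\<in>B. complex_of_real (c Z) * Z $$ (i, j)))"

definition deriv_along :: "complex mat \<Rightarrow> (complex mat \<Rightarrow> complex) \<Rightarrow> complex mat \<Rightarrow> complex" where
  "deriv_along Z \<phi> x = vector_derivative (\<lambda>s. \<phi> (x * one_param Z s)) (at 0)"

definition deriv2_along :: "complex mat \<Rightarrow> (complex mat \<Rightarrow> complex) \<Rightarrow> complex mat \<Rightarrow> complex" where
  "deriv2_along Z \<phi> x =
     vector_derivative (\<lambda>t. vector_derivative (\<lambda>s. \<phi> (x * one_param Z s)) (at t)) (at 0)"

definition twice_differentiable_along ::
    "nat \<Rightarrow> complex mat set \<Rightarrow> (complex mat \<Rightarrow> complex) \<Rightarrow> bool" where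
  "twice_differentiable_along n G \<phi> \<longleftrightarrow>
     (\<forall>x\<in>G. \<forall>Z\<in>lie_algebra n G. \<forall>t.
        (\<lambda>s. \<phi> (x * one_param Z s)) differentiable (at t) \<and>
        (\<lambda>u. vector_derivative (\<lambda>s. \<phi> (x * one_param Z s)) (at u)) differentiable (at t))"

(* The Laplacian and the conformality operator, computed with respect to the basis B. *)
definition tau :: "complex mat set \<Rightarrow> (complex mat \<Rightarrow> complex) \<Rightarrow> complex mat \<Rightarrow> complex" where
  "tau B \<phi> x = (\<Sum>Z\<in>B. deriv2_along Z \<phi> x)"

definition kappa ::
    "complex mat set \<Rightarrow> (complex mat \<Rightarrow> complex) \<Rightarrow> (complex mat \<Rightarrow> complex) \<Rightarrow> complex mat \<Rightarrow> complex"
  where "kappa B \<phi> \<psi> x = (\<Sum>Z\<in>B. deriv_along Z \<phi> x * deriv_along Z \<psi> x)"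

(* The constants may not depend on the orthonormal basis B.  Differentiability is required because
   vector_derivative has an arbitrary value where the derivative does not exist. *)
definition eigenfamily :: "nat \<Rightarrow> complex mat set \<Rightarrow> (complex mat \<Rightarrow> complex) set \<Rightarrow> bool" where
  "eigenfamily n G E \<longleftrightarrow>
     (\<forall>\<phi>\<in>E. twice_differentiable_along n G \<phi>) \<and>
     (\<exists>lam \<mu> :: complex. \<forall>B. orthonormal_basis n G B \<longrightarrow>
        (\<forall>\<phi>\<in>E. \<forall>x\<in>G. tau B \<phi> x = lam * \<phi> x) \<and>
        (\<forall>\<phi>\<in>E. \<forall>\<psi>\<in>E. \<forall>x\<in>G. kappa B \<phi> \<psi> x = \<mu> * \<phi> x * \<psi> x))"

(* "The union of E1 and E2 is a bi-eigenfamily"; being one is a property of the pair (E1, E2). *)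
definition bi_eigenfamily ::
    "nat \<Rightarrow> complex mat set \<Rightarrow> (complex mat \<Rightarrow> complex) set \<Rightarrow> (complex mat \<Rightarrow> complex) set \<Rightarrow> bool"
  where "bi_eigenfamily n G E1 E2 \<longleftrightarrow>
     E1 \<noteq> {} \<and> E2 \<noteq> {} \<and> eigenfamily n G E1 \<and> eigenfamily n G E2 \<and>
     (\<exists>\<mu> :: complex. \<forall>B. orthonormal_basis n G B \<longrightarrow>
        (\<forall>\<phi>\<in>E1. \<forall>\<psi>\<in>E2. \<forall>x\<in>G. kappa B \<phi> \<psi> x = \<mu> * \<phi> x * \<psi> x))"

(* Complex linear subspaces of the space of all functions from G to the complex numbers. *)
definition function_space_on :: "complex mat set \<Rightarrow> (complex mat \<Rightarrow> complex) set \<Rightarrow> bool" where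
  "function_space_on G E \<longleftrightarrow>
     E \<subseteq> extensional G \<and> (\<lambda>x\<in>G. 0) \<in> E \<and>
     (\<forall>\<phi>\<in>E. \<forall>\<psi>\<in>E. (\<lambda>x\<in>G. \<phi> x + \<psi> x) \<in> E) \<and>
     (\<forall>c. \<forall>\<phi>\<in>E. (\<lambda>x\<in>G. c * \<phi> x) \<in> E)"

definition I_pq :: "nat \<Rightarrow> nat \<Rightarrow> complex mat" where
  "I_pq p q = four_block_mat (- 1\<^sub>m p) (0\<^sub>m p q) (0\<^sub>m q p) (1\<^sub>m q)"

definition U_pq :: "nat \<Rightarrow> nat \<Rightarrow> complex mat set" where
  "U_pq p q = {z \<in> carrier_mat (p + q) (p + q).
     invertible_mat z \<and> z * I_pq p q * mat_adjoint z = I_pq p q}"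

definition C1 :: "nat \<Rightarrow> nat \<Rightarrow> complex vec set" where
  "C1 p q = {z @\<^sub>v 0\<^sub>v q | z. z \<in> carrier_vec p}"

definition C2 :: "nat \<Rightarrow> nat \<Rightarrow> complex vec set" where
  "C2 p q = {0\<^sub>v p @\<^sub>v w | w. w \<in> carrier_vec q}"

(* mat_of_rows n [v] is the 1 x n matrix of the row vector v. *)
definition phi :: "nat \<Rightarrow> nat \<Rightarrow> complex vec \<Rightarrow> complex vec \<Rightarrow> complex mat \<Rightarrow> complex" where
  "phi p q v a = (\<lambda>z\<in>U_pq p q.
     mat_trace (transpose_mat (mat_of_rows (p + q) [v]) * mat_of_rows (p + q) [a] * transpose_mat z))"

definition E1 :: "nat \<Rightarrow> nat \<Rightarrow> complex vec \<Rightarrow> (complex mat \<Rightarrow> complex) set" where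
  "E1 p q v = {phi p q v a | a. a \<in> C1 p q}"

definition E2 :: "nat \<Rightarrow> nat \<Rightarrow> complex vec \<Rightarrow> (complex mat \<Rightarrow> complex) set" where
  "E2 p q v = {phi p q v a | a. a \<in> C2 p q}"

end

theory Submission
  imports Defs
begin

text \<open>
  Write \<open>e\<^sub>i\<close> for the diagonal entries of the form: \<open>- 1\<close> for the first \<open>p\<close> indices and \<open>1\<close>
  for the others. Along the flow of a left-invariant field \<open>Z\<close> the function \<open>\<phi>\<^sub>a\<close> is
  \<open>\<phi>\<^sub>a (x exp (s Z)) = w exp (s Z) a\<^sup>t\<close> with the row \<open>w = v x\<close>. Hence its first and second
  derivatives are \<open>w Z a\<^sup>t\<close> and \<open>w Z\<^sup>2 a\<^sup>t\<close>, and both operators are determined by the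
  numbers \<open>\<Sum>Z\<in>B. Z\<^bsub>kl\<^esub> Z\<^bsub>ij\<^esub>\<close>.

  These numbers do not depend on the basis. Differentiating the equation of the group shows that
  the Lie algebra consists of the \<open>Z\<close> with \<open>cnj Z\<^bsub>ji\<^esub> = - e\<^sub>i e\<^sub>j Z\<^bsub>ij\<^esub>\<close>
  (\<open>lie_algebra_U_pq_iff\<close>). For each complex \<open>c\<close> it contains the matrix \<open>X c\<close> with entry \<open>c\<close>
  at \<open>(k, l)\<close> and \<open>- e\<^sub>k e\<^sub>l cnj c\<close> at \<open>(l, k)\<close> (the two are added if \<open>k = l\<close>), and the
  inner product of \<open>X c\<close> with \<open>Z\<close> is \<open>2 Re (c cnj Z\<^bsub>kl\<^esub>)\<close>. Expanding \<open>X 1\<close> and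
  \<open>X \<i>\<close> in the basis therefore recovers the real and the imaginary part of \<open>Z\<^bsub>kl\<^esub>\<close>, and
  \<open>2 \<Sum>Z\<in>B. Z\<^bsub>kl\<^esub> Z\<^bsub>ij\<^esub>\<close> is the entry \<open>(i, j)\<close> of \<open>X 1 + \<i> X \<i>\<close>. In this
  combination the entries \<open>c\<close> cancel, so what remains is \<open>- e\<^sub>k e\<^sub>l\<close> for
  \<open>(i, j) = (l, k)\<close> and \<open>0\<close> otherwise (\<open>orthonormal_basis_contraction\<close>).

  The two spaces of vectors \<open>a\<close> are the eigenspaces of the form: \<open>e\<^sub>j a\<^sub>j = s a\<^sub>j\<close> with
  \<open>s = - 1\<close> and \<open>s = 1\<close>. For \<open>a\<close> and \<open>b\<close> with eigenvalues \<open>s\<close> and \<open>t\<close>, contracting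
  gives \<open>\<tau> \<phi>\<^sub>a = - s (q - p) \<phi>\<^sub>a\<close> (\<open>tau_phi\<close>) and
  \<open>\<kappa> (\<phi>\<^sub>a, \<phi>\<^sub>b) = - s t \<phi>\<^sub>a \<phi>\<^sub>b\<close> (\<open>kappa_phi\<close>): the constant \<open>\<mu>\<close> is \<open>- 1\<close>
  within each family and \<open>1\<close> between them.
\<close>

section \<open>Entries of products and adjoints\<close>

lemma index_mult_mat_sum:
  assumes "A \<in> carrier_mat n n" "B \<in> carrier_mat n n" "i < n" "j < n"
  shows "(A * B) $$ (i, j) = (\<Sum>k<n. A $$ (i, k) * B $$ (k, j))"
  using assms by (simp add: scalar_prod_def atLeast0LessThan)

lemma index_mat_adjoint:
  fixes A :: "complex mat"
  assumes "A \<in> carrier_mat n n" "i < n" "j < n"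
  shows "mat_adjoint A $$ (i, j) = cnj (A $$ (j, i))"
  using assms by (simp add: mat_adjoint_def mat_of_rows_def)

lemma mat_adjoint_carrier [simp]:
  fixes A :: "complex mat"
  assumes "A \<in> carrier_mat n n"
  shows "mat_adjoint A \<in> carrier_mat n n"
  using assms by (auto simp: mat_adjoint_def mat_of_rows_def)

lemma mat_adjoint_mult:
  fixes A B :: "complex mat"
  assumes "A \<in> carrier_mat n n" "B \<in> carrier_mat n n"
  shows "mat_adjoint (A * B) = mat_adjoint B * mat_adjoint A"
proof (rule eq_matI)
  have c: "A * B \<in> carrier_mat n n" "mat_adjoint A \<in> carrier_mat n n" "mat_adjoint B \<in> carrier_mat n n"
    "mat_adjoint B * mat_adjoint A \<in> carrier_mat n n" "mat_adjoint (A * B) \<in> carrier_mat n n"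
    using assms by (auto intro!: mat_adjoint_carrier mult_carrier_mat[of _ n n _ n])
  show "dim_row (mat_adjoint (A * B)) = dim_row (mat_adjoint B * mat_adjoint A)"
    "dim_col (mat_adjoint (A * B)) = dim_col (mat_adjoint B * mat_adjoint A)"
    using c by (metis carrier_matD)+
  fix i j assume "i < dim_row (mat_adjoint B * mat_adjoint A)" "j < dim_col (mat_adjoint B * mat_adjoint A)"
  then have ij: "i < n" "j < n" using c by auto
  show "mat_adjoint (A * B) $$ (i, j) = (mat_adjoint B * mat_adjoint A) $$ (i, j)"
    using assms c ij
    by (simp add: index_mat_adjoint[of _ n] index_mult_mat_sum[of _ n] cnj_sum mult.commute
        del: index_mult_mat)
qed

section \<open>Derivatives of matrix curves and the exponential\<close>

text \<open>
  Entrywise, since matrices of arbitrary size do not form a normed vector space type.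
\<close>
definition has_mat_derivative ::
    "nat \<Rightarrow> (real \<Rightarrow> complex mat) \<Rightarrow> complex mat \<Rightarrow> real \<Rightarrow> bool" where
  "has_mat_derivative n F D t \<longleftrightarrow>
     (\<forall>i<n. \<forall>j<n. ((\<lambda>s. F s $$ (i, j)) has_vector_derivative D $$ (i, j)) (at t))"

lemma has_mat_derivative_const: "has_mat_derivative n (\<lambda>_. A) (0\<^sub>m n n) t"
  by (simp add: has_mat_derivative_def)

lemma has_mat_derivative_mult:
  assumes "\<And>s. F s \<in> carrier_mat n n" "\<And>s. G s \<in> carrier_mat n n"
    and "F' \<in> carrier_mat n n" "G' \<in> carrier_mat n n"
    and "has_mat_derivative n F F' t" "has_mat_derivative n G G' t"
  shows "has_mat_derivative n (\<lambda>s. F s * G s) (F t * G' + F' * G t) t"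
  unfolding has_mat_derivative_def
proof (intro allI impI)
  fix i j assume ij: "i < n" "j < n"
  have "((\<lambda>s. \<Sum>k<n. F s $$ (i, k) * G s $$ (k, j)) has_vector_derivative
      (\<Sum>k<n. F t $$ (i, k) * G' $$ (k, j) + F' $$ (i, k) * G t $$ (k, j))) (at t)"
    using assms(5,6) ij
    by (intro has_vector_derivative_sum has_vector_derivative_mult)
      (auto simp: has_mat_derivative_def)
  moreover have "(F t * G' + F' * G t) $$ (i, j) =
      (\<Sum>k<n. F t $$ (i, k) * G' $$ (k, j) + F' $$ (i, k) * G t $$ (k, j))"
    using ij assms(1)[of t] assms(2)[of t] assms(3,4)
    by (simp add: index_mult_mat_sum[of _ n] sum.distrib del: index_mult_mat(1))
  moreover have "(\<lambda>s. (F s * G s) $$ (i, j)) = (\<lambda>s. \<Sum>k<n. F s $$ (i, k) * G s $$ (k, j))"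
    using ij assms(1,2) by (intro ext index_mult_mat_sum)
  ultimately show "((\<lambda>s. (F s * G s) $$ (i, j)) has_vector_derivative
      (F t * G' + F' * G t) $$ (i, j)) (at t)"
    by simp
qed

lemma has_mat_derivative_mult_const:
  assumes "\<And>s. F s \<in> carrier_mat n n" "F' \<in> carrier_mat n n" "A \<in> carrier_mat n n"
    and "has_mat_derivative n F F' t"
  shows "has_mat_derivative n (\<lambda>s. F s * A) (F' * A) t"
proof -
  have "F t * 0\<^sub>m n n + F' * A = F' * A"
    using assms(1)[of t] assms(2,3) by simp
  then show ?thesis
    using has_mat_derivative_mult[OF assms(1) _ assms(2) _ assms(4) has_mat_derivative_const, of A]
      assms(3) by simp
qed

lemma has_mat_derivative_adjoint:
  assumes "\<And>s. F s \<in> carrier_mat n n" "F' \<in> carrier_mat n n" "has_mat_derivative n F F' t"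
  shows "has_mat_derivative n (\<lambda>s. mat_adjoint (F s)) (mat_adjoint F') t"
  using assms
  by (auto simp: has_mat_derivative_def index_mat_adjoint[of _ n] intro!: has_vector_derivative_cnj)

text \<open>
  An entry of a product is a sum of \<open>n\<close> terms, so each further factor costs at most \<open>n M\<close>. This
  geometric bound makes the entries of the exponential power series with infinite radius of
  convergence.
\<close>
lemma norm_index_pow_mat_le:
  assumes Z: "Z \<in> carrier_mat n n" and M: "\<And>i j. i < n \<Longrightarrow> j < n \<Longrightarrow> norm (Z $$ (i, j)) \<le> M"
    and ij: "i < n" "j < n"
  shows "norm ((Z ^\<^sub>m k) $$ (i, j) :: complex) \<le> (real n * M) ^ k"
  using ij
proof (induction k arbitrary: j)
  case 0
  then show ?case using Z by auto
next
  case (Suc k)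
  have "0 \<le> M" using order_trans[OF norm_ge_zero M[OF Suc.prems]] .
  have "norm ((Z ^\<^sub>m Suc k) $$ (i, j)) = norm (\<Sum>l<n. (Z ^\<^sub>m k) $$ (i, l) * Z $$ (l, j))"
    using Suc.prems Z index_mult_mat_sum[OF pow_carrier_mat[OF Z] Z] by simp
  also have "\<dots> \<le> (\<Sum>l<n. (real n * M) ^ k * M)"
    using Suc M \<open>0 \<le> M\<close> by (intro sum_norm_le) (auto simp: norm_mult intro!: mult_mono)
  also have "\<dots> = (real n * M) ^ Suc k"
    by simp
  finally show ?case .
qed

lemma summable_mat_exp_series:
  fixes y :: complex
  assumes Z: "Z \<in> carrier_mat n n" and ij: "i < n" "j < n"
  shows "summable (\<lambda>k. (Z ^\<^sub>m k) $$ (i, j) / fact k * y ^ k)"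
proof -
  define M where "M = (\<Sum>x\<in>{..<n} \<times> {..<n}. norm (Z $$ x))"
  have M: "norm (Z $$ (i, j)) \<le> M" if "i < n" "j < n" for i j
    unfolding M_def using that by (intro member_le_sum) auto
  have "summable (\<lambda>k. inverse (fact k) * (real n * M * norm y) ^ k)"
    by (rule summable_exp)
  then show ?thesis
  proof (rule summable_comparison_test')
    fix k
    have "norm ((Z ^\<^sub>m k) $$ (i, j) / fact k * y ^ k) =
        inverse (fact k) * (norm ((Z ^\<^sub>m k) $$ (i, j)) * norm y ^ k)"
      by (simp add: norm_mult norm_divide norm_power field_simps)
    also have "\<dots> \<le> inverse (fact k) * ((real n * M) ^ k * norm y ^ k)"
      using norm_index_pow_mat_le[OF Z M ij] by (intro mult_left_mono mult_right_mono) auto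
    finally show "norm ((Z ^\<^sub>m k) $$ (i, j) / fact k * y ^ k) \<le>
        inverse (fact k) * (real n * M * norm y) ^ k"
      by (simp add: power_mult_distrib)
  qed
qed

lemma index_smult_pow_mat:
  fixes c :: complex
  assumes Z: "Z \<in> carrier_mat n n" and ij: "i < n" "j < n"
  shows "((c \<cdot>\<^sub>m Z) ^\<^sub>m k) $$ (i, j) = c ^ k * (Z ^\<^sub>m k) $$ (i, j)"
  using ij
proof (induction k arbitrary: j)
  case 0
  then show ?case using Z by auto
next
  case (Suc k)
  have cZ: "c \<cdot>\<^sub>m Z \<in> carrier_mat n n" using Z by simp
  show ?case
    using Suc Z index_mult_mat_sum[OF pow_carrier_mat[OF Z, of k] Z]
      index_mult_mat_sum[OF pow_carrier_mat[OF cZ, of k] cZ]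
    by (simp add: sum_distrib_left mult_ac del: index_mult_mat(1))
qed

lemma one_param_carrier [simp]: "Z \<in> carrier_mat n n \<Longrightarrow> one_param Z s \<in> carrier_mat n n"
  by (auto simp: mat_exp_def)

lemma index_one_param:
  assumes "Z \<in> carrier_mat n n" "i < n" "j < n"
  shows "one_param Z s $$ (i, j) = (\<Sum>k. (Z ^\<^sub>m k) $$ (i, j) / fact k * complex_of_real s ^ k)"
  using assms by (simp add: mat_exp_def index_smult_pow_mat[of _ n] mult_ac)

lemma one_param_0:
  assumes Z: "Z \<in> carrier_mat n n"
  shows "one_param Z 0 = 1\<^sub>m n"
proof (rule eq_matI)
  fix i j assume "i < dim_row (1\<^sub>m n :: complex mat)" "j < dim_col (1\<^sub>m n :: complex mat)"
  then have ij: "i < n" "j < n" by auto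
  have "one_param Z 0 $$ (i, j) = (\<Sum>k. (Z ^\<^sub>m k) $$ (i, j) / fact k * 0 ^ k)"
    using index_one_param[OF Z ij, of 0] by simp
  also have "\<dots> = 1\<^sub>m n $$ (i, j)"
    using powser_zero[of "\<lambda>k. (Z ^\<^sub>m k) $$ (i, j) / fact k"] Z by simp
  finally show "one_param Z 0 $$ (i, j) = 1\<^sub>m n $$ (i, j)" .
qed (use Z in \<open>auto simp: mat_exp_def\<close>)

text \<open>
  Termwise differentiation replaces \<open>Z ^\<^sub>m k\<close> by \<open>Z ^\<^sub>m Suc k\<close>, whose entries are sums over a
  column of \<open>Z\<close>. The series is differentiated in a complex variable, which is then restricted to
  the reals.
\<close>
lemma has_mat_derivative_one_param:
  assumes Z: "Z \<in> carrier_mat n n"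
  shows "has_mat_derivative n (one_param Z) (one_param Z t * Z) t"
  unfolding has_mat_derivative_def
proof (intro allI impI)
  fix i j assume ij: "i < n" "j < n"
  let ?c = "\<lambda>j k. (Z ^\<^sub>m k) $$ (i, j) / fact k"
  let ?t = "complex_of_real t"
  have diffs: "diffs (?c j) k * ?t ^ k = (\<Sum>l<n. ?c l k * ?t ^ k * Z $$ (l, j))" for k
  proof -
    have "diffs (?c j) k = (Z ^\<^sub>m Suc k) $$ (i, j) / fact k"
      by (simp add: diffs_def field_simps del: pow_mat.simps of_nat_Suc)
    also have "\<dots> = (\<Sum>l<n. ?c l k * Z $$ (l, j))"
      using index_mult_mat_sum[OF pow_carrier_mat[OF Z] Z ij, of k]
      by (simp add: sum_divide_distrib)
    finally show ?thesis by (simp add: sum_distrib_left mult_ac)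
  qed
  have "(\<Sum>k. diffs (?c j) k * ?t ^ k) = (\<Sum>k. \<Sum>l<n. ?c l k * ?t ^ k * Z $$ (l, j))"
    by (simp only: diffs)
  also have "\<dots> = (\<Sum>l<n. \<Sum>k. ?c l k * ?t ^ k * Z $$ (l, j))"
    using ij summable_mat_exp_series[OF Z] by (intro suminf_sum summable_mult2) auto
  also have "\<dots> = (\<Sum>l<n. one_param Z t $$ (i, l) * Z $$ (l, j))"
    using ij by (intro sum.cong refl)
      (simp only: lessThan_iff index_one_param[OF Z] suminf_mult2[OF summable_mat_exp_series[OF Z]])
  also have "\<dots> = (one_param Z t * Z) $$ (i, j)"
    by (rule index_mult_mat_sum[OF one_param_carrier[OF Z] Z ij, symmetric])
  finally have "(\<Sum>k. diffs (?c j) k * ?t ^ k) = (one_param Z t * Z) $$ (i, j)" .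
  then have "((\<lambda>x. \<Sum>k. ?c j k * x ^ k) has_field_derivative (one_param Z t * Z) $$ (i, j)) (at ?t)"
    using termdiffs_strong_converges_everywhere[OF summable_mat_exp_series[OF Z ij], of ?t] by (simp only:)
  then show "((\<lambda>s. one_param Z s $$ (i, j)) has_vector_derivative (one_param Z t * Z) $$ (i, j)) (at t)"
    unfolding index_one_param[OF Z ij] by (rule has_vector_derivative_real_field)
qed


section \<open>The group and its Lie algebra\<close>

definition pq_sign :: "nat \<Rightarrow> nat \<Rightarrow> complex" where
  "pq_sign p i = (if i < p then - 1 else 1)"

lemma pq_sign_square [simp]: "pq_sign p i * pq_sign p i = 1"
  by (simp add: pq_sign_def)

lemma cnj_pq_sign [simp]: "cnj (pq_sign p i) = pq_sign p i"
  by (simp add: pq_sign_def)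

lemma I_pq_carrier [simp]: "I_pq p q \<in> carrier_mat (p + q) (p + q)"
  by (simp add: I_pq_def)

lemma index_I_pq:
  assumes "i < p + q" "j < p + q"
  shows "I_pq p q $$ (i, j) = (if i = j then pq_sign p i else 0)"
  using assms by (auto simp: I_pq_def pq_sign_def)

lemma index_mult_I_pq:
  assumes A: "A \<in> carrier_mat (p + q) (p + q)" and ij: "i < p + q" "j < p + q"
  shows "(A * I_pq p q) $$ (i, j) = A $$ (i, j) * pq_sign p j"
    and "(I_pq p q * A) $$ (i, j) = pq_sign p i * A $$ (i, j)"
proof -
  have "(\<Sum>k<p + q. A $$ (i, k) * I_pq p q $$ (k, j)) =
      (\<Sum>k<p + q. if k = j then A $$ (i, j) * pq_sign p j else 0)"
    using ij by (intro sum.cong) (auto simp: index_I_pq)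
  then show "(A * I_pq p q) $$ (i, j) = A $$ (i, j) * pq_sign p j"
    using ij by (simp add: index_mult_mat_sum[OF A I_pq_carrier ij])
  have "(\<Sum>k<p + q. I_pq p q $$ (i, k) * A $$ (k, j)) =
      (\<Sum>k<p + q. if k = i then pq_sign p i * A $$ (i, j) else 0)"
    using ij by (intro sum.cong) (auto simp: index_I_pq)
  then show "(I_pq p q * A) $$ (i, j) = pq_sign p i * A $$ (i, j)"
    using ij by (simp add: index_mult_mat_sum[OF I_pq_carrier A ij])
qed

lemma I_pq_square: "I_pq p q * I_pq p q = 1\<^sub>m (p + q)"
proof (rule eq_matI)
  fix i j assume "i < dim_row (1\<^sub>m (p + q) :: complex mat)" "j < dim_col (1\<^sub>m (p + q) :: complex mat)"
  then have ij: "i < p + q" "j < p + q" by auto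
  show "(I_pq p q * I_pq p q) $$ (i, j) = 1\<^sub>m (p + q) $$ (i, j)"
    using ij by (simp add: index_mult_I_pq(1)[OF I_pq_carrier ij] index_I_pq)
qed (auto simp: I_pq_def)

text \<open>
  The equation of the group makes \<open>I z\<^sup>* I\<close> a right inverse of \<open>z\<close>, and a right inverse of a
  square matrix is an inverse.
\<close>
lemma mem_U_pq_iff:
  "z \<in> U_pq p q \<longleftrightarrow>
     z \<in> carrier_mat (p + q) (p + q) \<and> z * I_pq p q * mat_adjoint z = I_pq p q"
proof -
  let ?I = "I_pq p q" and ?n = "p + q"
  have "invertible_mat z" if z: "z \<in> carrier_mat ?n ?n" and eq: "z * ?I * mat_adjoint z = ?I"
  proof -
    let ?w = "?I * mat_adjoint z * ?I"
    have w: "?w \<in> carrier_mat ?n ?n"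
      using z by (auto intro!: mult_carrier_mat[of _ ?n ?n _ ?n])
    have "z * ?w = z * ?I * mat_adjoint z * ?I"
      using z mat_adjoint_carrier[OF z]
      by (simp add: assoc_mult_mat[of _ ?n ?n _ ?n _ ?n] mult_carrier_mat[of _ ?n ?n _ ?n])
    also have "\<dots> = 1\<^sub>m ?n"
      by (simp add: eq I_pq_square)
    finally have zw: "z * ?w = 1\<^sub>m ?n" .
    moreover have "?w * z = 1\<^sub>m ?n"
      by (rule mat_mult_left_right_inverse[OF z w zw])
    ultimately show ?thesis
      unfolding invertible_mat_def inverts_mat_def using z w by (metis carrier_matD square_mat.simps)
  qed
  then show ?thesis
    by (auto simp: U_pq_def)
qed

lemma U_pq_mult:
  assumes "x \<in> U_pq p q" "y \<in> U_pq p q"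
  shows "x * y \<in> U_pq p q"
proof -
  let ?n = "p + q" and ?I = "I_pq p q"
  have xy: "x \<in> carrier_mat ?n ?n" "y \<in> carrier_mat ?n ?n"
    "mat_adjoint x \<in> carrier_mat ?n ?n" "mat_adjoint y \<in> carrier_mat ?n ?n"
    using assms by (auto simp: mem_U_pq_iff)
  have "x * y * ?I * mat_adjoint (x * y) = x * (y * ?I * mat_adjoint y) * mat_adjoint x"
    using xy by (simp add: mat_adjoint_mult[of _ ?n] assoc_mult_mat[of _ ?n ?n _ ?n _ ?n]
      mult_carrier_mat[of _ ?n ?n _ ?n])
  also have "\<dots> = ?I"
    using assms by (simp add: mem_U_pq_iff)
  finally show ?thesis
    using xy by (auto simp: mem_U_pq_iff)
qed

text \<open>
  The derivative is the Lie algebra condition conjugated by the flow. Taken at \<open>0\<close> it shows that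
  this condition is necessary; since it vanishes for all \<open>t\<close> if the condition holds, the flow then
  stays in the group.
\<close>
lemma has_mat_derivative_form_one_param:
  assumes Z: "Z \<in> carrier_mat (p + q) (p + q)"
  shows "has_mat_derivative (p + q)
     (\<lambda>s. one_param Z s * I_pq p q * mat_adjoint (one_param Z s))
     (one_param Z t * (Z * I_pq p q + I_pq p q * mat_adjoint Z) * mat_adjoint (one_param Z t)) t"
proof -
  let ?n = "p + q" and ?I = "I_pq p q" and ?E = "one_param Z"
  have E: "?E s \<in> carrier_mat ?n ?n" "mat_adjoint (?E s) \<in> carrier_mat ?n ?n" for s
    using Z by (auto intro!: mat_adjoint_carrier one_param_carrier)
  have Z': "mat_adjoint Z \<in> carrier_mat ?n ?n" using Z by simp
  note mc = mult_carrier_mat[of _ ?n ?n _ ?n]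
  note as = assoc_mult_mat[of _ ?n ?n _ ?n _ ?n]
  have "has_mat_derivative ?n (\<lambda>s. ?E s * ?I * mat_adjoint (?E s))
      (?E t * ?I * mat_adjoint (?E t * Z) + ?E t * Z * ?I * mat_adjoint (?E t)) t"
    using E Z
    by (intro has_mat_derivative_mult has_mat_derivative_adjoint has_mat_derivative_mult_const
        has_mat_derivative_one_param mc mat_adjoint_carrier) auto
  also have "?E t * ?I * mat_adjoint (?E t * Z) + ?E t * Z * ?I * mat_adjoint (?E t) =
      ?E t * (Z * ?I) * mat_adjoint (?E t) + ?E t * (?I * mat_adjoint Z) * mat_adjoint (?E t)"
    using E[of t] Z Z'
    by (subst comm_add_mat[of _ ?n ?n]) (simp_all add: mat_adjoint_mult[of _ ?n] as mc)
  also have "\<dots> = ?E t * (Z * ?I + ?I * mat_adjoint Z) * mat_adjoint (?E t)"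
    using E[of t] Z Z'
    by (simp add: mc mult_add_distrib_mat[of _ ?n ?n _ ?n] add_mult_distrib_mat[of _ ?n ?n _ _ ?n])
  finally show ?thesis .
qed

lemma lie_algebra_U_pq_iff:
  "Z \<in> lie_algebra (p + q) (U_pq p q) \<longleftrightarrow>
     Z \<in> carrier_mat (p + q) (p + q) \<and>
     (\<forall>i<p + q. \<forall>j<p + q. cnj (Z $$ (j, i)) = - pq_sign p i * pq_sign p j * Z $$ (i, j))"
    (is "?L \<longleftrightarrow> ?C \<and> ?R")
proof -
  let ?n = "p + q" and ?I = "I_pq p q" and ?E = "one_param Z"
  let ?D = "Z * ?I + ?I * mat_adjoint Z"
  let ?F = "\<lambda>s. ?E s * ?I * mat_adjoint (?E s)"
  have "?L \<longleftrightarrow> ?R" if Z: ?C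
  proof -
    have Z': "mat_adjoint Z \<in> carrier_mat ?n ?n" using Z by simp
    have D: "?D \<in> carrier_mat ?n ?n"
      using Z Z' by (auto intro!: add_carrier_mat mult_carrier_mat[of _ ?n ?n _ ?n])
    have E: "?E s \<in> carrier_mat ?n ?n" "mat_adjoint (?E s) \<in> carrier_mat ?n ?n" for s
      using Z by (auto intro!: mat_adjoint_carrier one_param_carrier)
    have adj1: "mat_adjoint (1\<^sub>m ?n) = (1\<^sub>m ?n :: complex mat)"
      by (rule eq_matI) (auto simp: mat_adjoint_def mat_of_rows_def)
    have F0: "?F 0 = ?I"
      by (simp add: one_param_0[OF Z] adj1 left_mult_one_mat[of _ ?n ?n] right_mult_one_mat[of _ ?n ?n] del: of_real_0)
    have D_eq: "?D $$ (i, j) = Z $$ (i, j) * pq_sign p j + pq_sign p i * cnj (Z $$ (j, i))"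
      if "i < ?n" "j < ?n" for i j
      using that Z Z' carrier_matD[OF Z'] carrier_matD[OF I_pq_carrier[of p q]]
      by (simp add: index_mult_I_pq index_mat_adjoint[of _ ?n] del: index_mult_mat(1))
    have R_iff: "?R \<longleftrightarrow> ?D = 0\<^sub>m ?n ?n"
    proof -
      have "?D $$ (i, j) = 0 \<longleftrightarrow> cnj (Z $$ (j, i)) = - pq_sign p i * pq_sign p j * Z $$ (i, j)"
        if "i < ?n" "j < ?n" for i j
      proof -
        have "?D $$ (i, j) =
            pq_sign p i * (cnj (Z $$ (j, i)) + pq_sign p i * pq_sign p j * Z $$ (i, j))"
          unfolding D_eq[OF that] by (simp add: pq_sign_def)
        moreover have "pq_sign p i \<noteq> 0" by (simp add: pq_sign_def)
        ultimately show ?thesis by (simp only: mult_eq_0_iff eq_neg_iff_add_eq_0 mult_minus_left) simp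
      qed
      moreover have "?D = 0\<^sub>m ?n ?n \<longleftrightarrow> (\<forall>i<?n. \<forall>j<?n. ?D $$ (i, j) = 0)"
        using D by (auto intro!: eq_matI)
      ultimately show ?thesis by simp
    qed
    show ?thesis
    proof
      assume ?L
      then have F: "?F s = ?I" for s
        by (auto simp: lie_algebra_def mem_U_pq_iff)
      have "has_mat_derivative ?n (\<lambda>s. ?I) (?E 0 * ?D * mat_adjoint (?E 0)) 0"
        using has_mat_derivative_form_one_param[OF Z, of 0] unfolding F .
      then have "has_mat_derivative ?n (\<lambda>s. ?I) ?D 0"
        using D by (simp add: one_param_0[OF Z] adj1 left_mult_one_mat[of _ ?n ?n] right_mult_one_mat[of _ ?n ?n] del: of_real_0)
      then have "?D $$ (i, j) = 0" if "i < ?n" "j < ?n" for i j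
        using that unfolding has_mat_derivative_def
        by (metis has_vector_derivative_const vector_derivative_unique_at)
      then have "?D = 0\<^sub>m ?n ?n"
        using D by (intro eq_matI) auto
      then show ?R using R_iff by simp
    next
      assume ?R
      then have "?D = 0\<^sub>m ?n ?n" using R_iff by simp
      then have deriv: "has_mat_derivative ?n ?F (0\<^sub>m ?n ?n) t" for t
        using has_mat_derivative_form_one_param[OF Z, of t] E[of t]
        by (simp add: right_mult_zero_mat[of _ ?n ?n] left_mult_zero_mat[of _ ?n ?n])
      have "?F t = ?I" for t
      proof (rule eq_matI)
        fix i j assume "i < dim_row ?I" "j < dim_col ?I"
        then have ij: "i < ?n" "j < ?n" using carrier_matD[OF I_pq_carrier[of p q]] by auto
        obtain c where "\<And>t. ?F t $$ (i, j) = c"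
          using has_vector_derivative_zero_constant[of UNIV "\<lambda>t. ?F t $$ (i, j)"] deriv ij
          by (auto simp: has_mat_derivative_def)
        then show "?F t $$ (i, j) = ?I $$ (i, j)" using F0 by metis
      qed (use carrier_matD[OF E(2)[of t]] E(1)[of t] in \<open>auto simp: I_pq_def\<close>)
      then show ?L
        using Z E by (auto simp: lie_algebra_def mem_U_pq_iff)
    qed
  qed
  then show ?thesis by (auto simp: lie_algebra_def)
qed

section \<open>Contraction over an orthonormal basis\<close>

lemma lie_inner_eq_sum:
  assumes "Z \<in> carrier_mat n n" "W \<in> carrier_mat n n"
  shows "lie_inner Z W = (\<Sum>i<n. \<Sum>j<n. Re (Z $$ (i, j) * cnj (W $$ (i, j))))"
  using assms mat_adjoint_carrier[OF assms(2)]
  by (simp add: lie_inner_def mat_trace_def index_mult_mat_sum[of _ n] index_mat_adjoint[of _ n]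
      del: index_mult_mat(1))

lemma orthonormal_basis_expansion:
  assumes B: "orthonormal_basis n G B" and X: "X \<in> lie_algebra n G" and ij: "i < n" "j < n"
  shows "X $$ (i, j) = (\<Sum>Z\<in>B. complex_of_real (lie_inner X Z) * Z $$ (i, j))"
proof -
  have fin: "finite B" and BC: "Z \<in> B \<Longrightarrow> Z \<in> carrier_mat n n"
    and orth: "Z \<in> B \<Longrightarrow> W \<in> B \<Longrightarrow> lie_inner Z W = (if Z = W then 1 else 0)" for Z W
    using B by (auto simp: orthonormal_basis_def lie_algebra_def)
  have XC: "X \<in> carrier_mat n n" using X by (simp add: lie_algebra_def)
  obtain c :: "complex mat \<Rightarrow> real" where
    c: "\<forall>i<n. \<forall>j<n. X $$ (i, j) = (\<Sum>Z\<in>B. complex_of_real (c Z) * Z $$ (i, j))"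
    using B X unfolding orthonormal_basis_def by blast
  have "lie_inner X W = c W" if W: "W \<in> B" for W
  proof -
    have "lie_inner X W = (\<Sum>i<n. \<Sum>j<n. \<Sum>Z\<in>B. c Z * Re (Z $$ (i, j) * cnj (W $$ (i, j))))"
      unfolding lie_inner_eq_sum[OF XC BC[OF W]]
      by (intro sum.cong refl) (simp add: c sum_distrib_right mult.assoc)
    also have "\<dots> = (\<Sum>Z\<in>B. \<Sum>i<n. \<Sum>j<n. c Z * Re (Z $$ (i, j) * cnj (W $$ (i, j))))"
      by (simp only: sum.swap[of _ B])
    also have "\<dots> = (\<Sum>Z\<in>B. c Z * lie_inner Z W)"
      by (intro sum.cong refl) (simp only: lie_inner_eq_sum[OF BC BC[OF W]] sum_distrib_left)
    also have "\<dots> = (\<Sum>Z\<in>B. if Z = W then c W else 0)"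
      using W orth by (intro sum.cong) auto
    finally show ?thesis using fin W by simp
  qed
  then show ?thesis using c ij by simp
qed

lemma sum_sum_delta:
  fixes f :: "nat \<Rightarrow> nat \<Rightarrow> 'a::comm_monoid_add"
  assumes "k < n" "l < n"
  shows "(\<Sum>i<n. \<Sum>j<n. if i = k \<and> j = l then f i j else 0) = f k l"
proof -
  have "(\<Sum>j<n. if i = k \<and> j = l then f i j else 0) = (if i = k then f k l else 0)" for i
    using assms by auto
  then show ?thesis using assms by simp
qed

text \<open>
  The products are bilinear over the complex numbers while the basis is only a real one. Evaluating
  the real expansion on \<open>X 1\<close> and \<open>X \<i>\<close> bridges the two, because together their coefficients
  give \<open>2 Z\<^bsub>kl\<^esub> = 2 Re (cnj Z\<^bsub>kl\<^esub>) + \<i> 2 Re (\<i> cnj Z\<^bsub>kl\<^esub>)\<close>.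
\<close>
lemma orthonormal_basis_contraction:
  assumes B: "orthonormal_basis (p + q) (U_pq p q) B"
    and kl: "k < p + q" "l < p + q" and ij: "i < p + q" "j < p + q"
  shows "(\<Sum>Z\<in>B. Z $$ (k, l) * Z $$ (i, j)) =
    (if j = k \<and> i = l then - pq_sign p k * pq_sign p l else 0)"
proof -
  let ?n = "p + q"
  let ?s = "pq_sign p k * pq_sign p l"
  have ss: "?s * (?s * y) = y" for y
    by (simp add: pq_sign_def)
  (* If k = l, then P i j and P j i hold together and both contributions to X are present. *)
  define P where "P i j \<longleftrightarrow> i = k \<and> j = l" for i j
  define X where "X c = mat ?n ?n (\<lambda>(i, j).
    (if P i j then c else 0) - (if P j i then ?s * cnj c else 0))" for c
  have index_X: "X c $$ (i, j) = (if P i j then c else 0) - (if P j i then ?s * cnj c else 0)"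
    if "i < ?n" "j < ?n" for c i j
    using that by (simp add: X_def)
  have X_carrier: "X c \<in> carrier_mat ?n ?n" for c
    by (simp add: X_def)
  have X_lie: "X c \<in> lie_algebra ?n (U_pq p q)" for c
    unfolding lie_algebra_U_pq_iff
  proof (intro conjI allI impI X_carrier)
    fix i j assume ij: "i < ?n" "j < ?n"
    have "cnj (X c $$ (j, i)) = - (?s * X c $$ (i, j))"
      using ss by (simp add: index_X ij right_diff_distrib)
    moreover have "pq_sign p i * pq_sign p j = ?s" if "P i j \<or> P j i"
      using that by (auto simp: P_def mult.commute)
    moreover have "X c $$ (i, j) = 0" if "\<not> P i j" "\<not> P j i"
      using that by (simp add: index_X ij)
    ultimately show "cnj (X c $$ (j, i)) = - pq_sign p i * pq_sign p j * X c $$ (i, j)"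
      by (cases "P i j \<or> P j i") auto
  qed
  have lie: "Z \<in> carrier_mat ?n ?n" "cnj (Z $$ (l, k)) = - ?s * Z $$ (k, l)" if "Z \<in> B" for Z
  proof -
    have "Z \<in> lie_algebra ?n (U_pq p q)"
      using that B by (auto simp: orthonormal_basis_def)
    then show "Z \<in> carrier_mat ?n ?n" "cnj (Z $$ (l, k)) = - ?s * Z $$ (k, l)"
      using kl unfolding lie_algebra_U_pq_iff by simp_all
  qed
  have inner: "lie_inner (X c) Z = 2 * Re (c * cnj (Z $$ (k, l)))" if Z: "Z \<in> B" for c Z
  proof -
    have "lie_inner (X c) Z = (\<Sum>i<?n. \<Sum>j<?n.
        (if P i j then Re (c * cnj (Z $$ (i, j))) else 0) -
        (if P j i then Re (?s * cnj c * cnj (Z $$ (i, j))) else 0))"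
      unfolding lie_inner_eq_sum[OF X_carrier lie(1)[OF Z]]
      by (intro sum.cong refl) (auto simp: index_X left_diff_distrib simp del: times_complex.sel)
    also have "\<dots> =
        (\<Sum>i<?n. \<Sum>j<?n. if P i j then Re (c * cnj (Z $$ (i, j))) else 0) -
        (\<Sum>j<?n. \<Sum>i<?n. if P j i then Re (?s * cnj c * cnj (Z $$ (i, j))) else 0)"
      by (simp only: sum_subtractf) (subst (2) sum.swap, rule refl)
    also have "\<dots> = Re (c * cnj (Z $$ (k, l))) - Re (?s * cnj c * cnj (Z $$ (l, k)))"
      unfolding P_def using kl by (simp only: sum_sum_delta)
    also have "?s * cnj c * cnj (Z $$ (l, k)) = - cnj (c * cnj (Z $$ (k, l)))"
      unfolding lie(2)[OF Z] using ss[of "cnj c * Z $$ (k, l)"] by (simp add: mult_ac)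
    finally show ?thesis by simp
  qed
  have expand:
    "X c $$ (i, j) = (\<Sum>Z\<in>B. complex_of_real (2 * Re (c * cnj (Z $$ (k, l)))) * Z $$ (i, j))" for c
    unfolding orthonormal_basis_expansion[OF B X_lie ij] by (intro sum.cong refl) (simp only: inner)
  have "2 * (\<Sum>Z\<in>B. Z $$ (k, l) * Z $$ (i, j)) = X 1 $$ (i, j) + \<i> * X \<i> $$ (i, j)"
    unfolding expand sum_distrib_left sum.distrib[symmetric]
  proof (intro sum.cong refl)
    fix Z :: "complex mat"
    have "2 * Z $$ (k, l) = complex_of_real (2 * Re (1 * cnj (Z $$ (k, l)))) +
        \<i> * complex_of_real (2 * Re (\<i> * cnj (Z $$ (k, l))))"
      by (simp add: complex_eq_iff)
    then show "2 * (Z $$ (k, l) * Z $$ (i, j)) =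
        complex_of_real (2 * Re (1 * cnj (Z $$ (k, l)))) * Z $$ (i, j) +
        \<i> * (complex_of_real (2 * Re (\<i> * cnj (Z $$ (k, l)))) * Z $$ (i, j))"
      by (metis (no_types, lifting) distrib_right mult.assoc)
  qed
  also have "\<dots> = 2 * (if P j i then - ?s else 0)"
    by (simp add: index_X ij algebra_simps)
  finally show ?thesis by (simp add: P_def)
qed


section \<open>The functions and the operators applied to them\<close>

text \<open>
  The scalar \<open>w W a\<^sup>t\<close>. The row is a function of the index, so that the sums that arise as the
  entries of \<open>v x\<close> can be put in its place directly.
\<close>
definition row_form :: "nat \<Rightarrow> (nat \<Rightarrow> complex) \<Rightarrow> complex mat \<Rightarrow> complex vec \<Rightarrow> complex" where
  "row_form n w W a = (\<Sum>k<n. \<Sum>l<n. w k * W $$ (k, l) * a $ l)"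

lemma phi_eq_row_form:
  assumes v: "v \<in> carrier_vec (p + q)" and a: "a \<in> carrier_vec (p + q)" and z: "z \<in> U_pq p q"
  shows "phi p q v a z = row_form (p + q) (\<lambda>k. v $ k) z a"
proof -
  let ?n = "p + q"
  let ?A = "transpose_mat (mat_of_rows ?n [v]) * mat_of_rows ?n [a]"
  have zc: "z \<in> carrier_mat ?n ?n" using z by (simp add: U_pq_def)
  have A: "?A \<in> carrier_mat ?n ?n" by (rule carrier_matI) simp_all
  have index_A: "?A $$ (i, j) = v $ i * a $ j" if "i < ?n" "j < ?n" for i j
    using that v a by (simp add: scalar_prod_def mat_of_rows_def)
  have "phi p q v a z = (\<Sum>i<?n. \<Sum>j<?n. ?A $$ (i, j) * transpose_mat z $$ (j, i))"
    using z zc A by (simp add: phi_def mat_trace_def index_mult_mat_sum[OF A] del: index_mult_mat(1))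
  also have "\<dots> = row_form ?n (\<lambda>k. v $ k) z a"
    unfolding row_form_def using zc
    by (intro sum.cong refl) (simp add: index_A del: index_mult_mat(1))
  finally show ?thesis .
qed

text \<open>
  A left factor can be absorbed into the row. This turns a statement at a point \<open>x\<close> of the group
  into one at the identity, for the row \<open>v x\<close>.
\<close>
lemma row_form_mult:
  assumes "x \<in> carrier_mat n n" "W \<in> carrier_mat n n"
  shows "row_form n w (x * W) a = row_form n (\<lambda>k. \<Sum>i<n. w i * x $$ (i, k)) W a"
proof -
  have "row_form n w (x * W) a = (\<Sum>i<n. \<Sum>l<n. \<Sum>k<n. w i * x $$ (i, k) * W $$ (k, l) * a $ l)"
    unfolding row_form_def using assms
    by (intro sum.cong refl)
      (simp add: index_mult_mat_sum[of _ n] sum_distrib_left sum_distrib_right mult_ac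
        del: index_mult_mat(1))
  also have "\<dots> = (\<Sum>i<n. \<Sum>k<n. \<Sum>l<n. w i * x $$ (i, k) * W $$ (k, l) * a $ l)"
    by (intro sum.cong refl sum.swap)
  also have "\<dots> = (\<Sum>k<n. \<Sum>i<n. \<Sum>l<n. w i * x $$ (i, k) * W $$ (k, l) * a $ l)"
    by (rule sum.swap)
  also have "\<dots> = (\<Sum>k<n. \<Sum>l<n. \<Sum>i<n. w i * x $$ (i, k) * W $$ (k, l) * a $ l)"
    by (intro sum.cong refl sum.swap)
  also have "\<dots> = row_form n (\<lambda>k. \<Sum>i<n. w i * x $$ (i, k)) W a"
    by (simp add: row_form_def sum_distrib_right)
  finally show ?thesis .
qed

lemma row_form_one: "row_form n w (1\<^sub>m n) a = (\<Sum>k<n. w k * a $ k)"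
  unfolding row_form_def
proof (intro sum.cong refl)
  fix k assume "k \<in> {..<n}"
  then have "(\<Sum>l<n. w k * 1\<^sub>m n $$ (k, l) * a $ l) = (\<Sum>l<n. if l = k then w k * a $ k else 0)"
    by (intro sum.cong) auto
  then show "(\<Sum>l<n. w k * 1\<^sub>m n $$ (k, l) * a $ l) = w k * a $ k"
    using \<open>k \<in> {..<n}\<close> by simp
qed

lemma has_vector_derivative_row_form:
  assumes "has_mat_derivative n F D t"
  shows "((\<lambda>s. row_form n w (F s) a) has_vector_derivative row_form n w D a) (at t)"
  using assms unfolding row_form_def has_mat_derivative_def
  by (intro has_vector_derivative_sum has_vector_derivative_mult_left has_vector_derivative_mult_right)
    auto

text \<open>The row vector \<open>v x\<close>.\<close>
definition translated_row :: "nat \<Rightarrow> complex vec \<Rightarrow> complex mat \<Rightarrow> nat \<Rightarrow> complex" where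
  "translated_row n v x = (\<lambda>k. \<Sum>i<n. v $ i * x $$ (i, k))"

text \<open>
  Closure of the group under products keeps the curve inside the domain of the function, where it is
  linear in the matrix; so only the exponential has to be differentiated.
\<close>
lemma phi_derivatives:
  assumes v: "v \<in> carrier_vec (p + q)" and a: "a \<in> carrier_vec (p + q)"
    and x: "x \<in> U_pq p q" and Z: "Z \<in> lie_algebra (p + q) (U_pq p q)"
  defines "w \<equiv> translated_row (p + q) v x"
  shows "((\<lambda>s. phi p q v a (x * one_param Z s)) has_vector_derivative
      row_form (p + q) w (one_param Z t * Z) a) (at t)"
    and "((\<lambda>u. vector_derivative (\<lambda>s. phi p q v a (x * one_param Z s)) (at u)) has_vector_derivative
      row_form (p + q) w (one_param Z t * Z * Z) a) (at t)"
proof -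
  let ?n = "p + q" and ?E = "one_param Z"
  have xc: "x \<in> carrier_mat ?n ?n" and Zc: "Z \<in> carrier_mat ?n ?n"
    using x Z by (auto simp: U_pq_def lie_algebra_def)
  have Ec: "?E s \<in> carrier_mat ?n ?n" for s using Zc by (rule one_param_carrier)
  have "x * ?E s \<in> U_pq p q" for s
    using x Z by (intro U_pq_mult) (auto simp: lie_algebra_def)
  then have curve: "phi p q v a (x * ?E s) = row_form ?n w (?E s) a" for s
    unfolding w_def translated_row_def by (simp only: phi_eq_row_form[OF v a] row_form_mult[OF xc Ec])
  have E': "has_mat_derivative ?n ?E (?E t * Z) t" for t
    by (rule has_mat_derivative_one_param[OF Zc])
  have first: "((\<lambda>s. phi p q v a (x * ?E s)) has_vector_derivative row_form ?n w (?E t * Z) a) (at t)" for t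
    unfolding curve by (rule has_vector_derivative_row_form[OF E'])
  then show "((\<lambda>s. phi p q v a (x * ?E s)) has_vector_derivative row_form ?n w (?E t * Z) a) (at t)" .
  have "vector_derivative (\<lambda>s. phi p q v a (x * ?E s)) (at u) = row_form ?n w (?E u * Z) a" for u
    by (rule vector_derivative_at[OF first])
  moreover have "has_mat_derivative ?n (\<lambda>s. ?E s * Z) (?E t * Z * Z) t"
    using Zc Ec by (intro has_mat_derivative_mult_const E' mult_carrier_mat) auto
  ultimately show "((\<lambda>u. vector_derivative (\<lambda>s. phi p q v a (x * ?E s)) (at u)) has_vector_derivative
      row_form ?n w (?E t * Z * Z) a) (at t)"
    by (simp only: has_vector_derivative_row_form)
qed

lemma twice_differentiable_along_phi:
  assumes "v \<in> carrier_vec (p + q)" "a \<in> carrier_vec (p + q)"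
  shows "twice_differentiable_along (p + q) (U_pq p q) (phi p q v a)"
  unfolding twice_differentiable_along_def
  using phi_derivatives[OF assms] by (blast intro: differentiableI_vector)

lemma deriv_along_phi:
  assumes "v \<in> carrier_vec (p + q)" "a \<in> carrier_vec (p + q)" "x \<in> U_pq p q"
    and Z: "Z \<in> lie_algebra (p + q) (U_pq p q)"
  shows "deriv_along Z (phi p q v a) x = row_form (p + q) (translated_row (p + q) v x) Z a"
    and "deriv2_along Z (phi p q v a) x = row_form (p + q) (translated_row (p + q) v x) (Z * Z) a"
proof -
  have Zc: "Z \<in> carrier_mat (p + q) (p + q)" using Z by (simp add: lie_algebra_def)
  have "one_param Z 0 * Z = Z"
    using left_mult_one_mat[OF Zc] by (simp only: one_param_0[OF Zc])
  then show "deriv_along Z (phi p q v a) x = row_form (p + q) (translated_row (p + q) v x) Z a"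
    "deriv2_along Z (phi p q v a) x = row_form (p + q) (translated_row (p + q) v x) (Z * Z) a"
    unfolding deriv_along_def deriv2_along_def
    using vector_derivative_at[OF phi_derivatives(1)[OF assms, of 0]]
      vector_derivative_at[OF phi_derivatives(2)[OF assms, of 0]]
    by (simp_all only:)
qed

lemma phi_eq_translated_row:
  assumes "v \<in> carrier_vec (p + q)" "a \<in> carrier_vec (p + q)" and x: "x \<in> U_pq p q"
  shows "phi p q v a x = (\<Sum>k<p + q. translated_row (p + q) v x k * a $ k)"
proof -
  have xc: "x \<in> carrier_mat (p + q) (p + q)" using x by (simp add: U_pq_def)
  show ?thesis
    using phi_eq_row_form[OF assms] row_form_mult[OF xc one_carrier_mat, of "\<lambda>k. v $ k" a]
    by (simp add: right_mult_one_mat[OF xc] row_form_one translated_row_def)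
qed

text \<open>
  The eigenspace of the form for \<open>s\<close>. Both families come from such a space, so every property of
  them is proved once, with \<open>s\<close> as a parameter.
\<close>
definition sign_eigenspace :: "nat \<Rightarrow> nat \<Rightarrow> complex \<Rightarrow> complex vec set" where
  "sign_eigenspace p q s =
     {a \<in> carrier_vec (p + q). \<forall>j<p + q. pq_sign p j * a $ j = s * a $ j}"

lemma C1_eq_sign_eigenspace: "C1 p q = sign_eigenspace p q (- 1)"
proof (intro equalityI subsetI)
  fix a assume "a \<in> C1 p q"
  then show "a \<in> sign_eigenspace p q (- 1)"
    by (auto simp: C1_def sign_eigenspace_def pq_sign_def)
next
  fix a assume a: "a \<in> sign_eigenspace p q (- 1)"
  then have "a $ j = 0" if "p \<le> j" "j < p + q" for j
    using that by (auto simp: sign_eigenspace_def pq_sign_def dest!: spec[of _ j])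
  then have "a = vec_first a p @\<^sub>v 0\<^sub>v q"
    using a by (intro eq_vecI) (auto simp: sign_eigenspace_def vec_first_def)
  moreover have "vec_first a p \<in> carrier_vec p" by simp
  ultimately show "a \<in> C1 p q" unfolding C1_def by blast
qed

lemma C2_eq_sign_eigenspace: "C2 p q = sign_eigenspace p q 1"
proof (intro equalityI subsetI)
  fix a assume "a \<in> C2 p q"
  then show "a \<in> sign_eigenspace p q 1"
    by (auto simp: C2_def sign_eigenspace_def pq_sign_def)
next
  fix a assume a: "a \<in> sign_eigenspace p q 1"
  then have "a $ j = 0" if "j < p" for j
    using that by (auto simp: sign_eigenspace_def pq_sign_def dest!: spec[of _ j])
  then have "a = 0\<^sub>v p @\<^sub>v vec_last a q"
    using a by (intro eq_vecI) (auto simp: sign_eigenspace_def vec_last_def)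
  moreover have "vec_last a q \<in> carrier_vec q" by simp
  ultimately show "a \<in> C2 p q" unfolding C2_def by blast
qed

text \<open>
  Contracting the inner index shows that the sum of the squares \<open>Z\<^sup>2\<close> is minus the trace of the form
  times the form itself. This matrix acts on \<open>a\<close> as a scalar, because \<open>a\<close> is an eigenvector.
\<close>
lemma tau_phi:
  assumes B: "orthonormal_basis (p + q) (U_pq p q) B" and v: "v \<in> carrier_vec (p + q)"
    and a: "a \<in> sign_eigenspace p q s" and x: "x \<in> U_pq p q"
  shows "tau B (phi p q v a) x = - s * (\<Sum>m<p + q. pq_sign p m) * phi p q v a x"
proof -
  let ?n = "p + q"
  let ?w = "translated_row ?n v x"
  let ?r = "\<Sum>m<?n. pq_sign p m"
  have BL: "Z \<in> lie_algebra ?n (U_pq p q)" and BC: "Z \<in> carrier_mat ?n ?n" if "Z \<in> B" for Z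
    using B that by (auto simp: orthonormal_basis_def lie_algebra_def)
  have ac: "a \<in> carrier_vec ?n" and as: "j < ?n \<Longrightarrow> pq_sign p j * a $ j = s * a $ j" for j
    using a by (auto simp: sign_eigenspace_def)
  have square: "(\<Sum>Z\<in>B. (Z * Z) $$ (k, l)) = (if l = k then - pq_sign p k * ?r else 0)"
    if "k < ?n" "l < ?n" for k l
  proof -
    have "(\<Sum>Z\<in>B. (Z * Z) $$ (k, l)) = (\<Sum>Z\<in>B. \<Sum>m<?n. Z $$ (k, m) * Z $$ (m, l))"
      using that by (intro sum.cong refl index_mult_mat_sum BC)
    also have "\<dots> = (\<Sum>m<?n. \<Sum>Z\<in>B. Z $$ (k, m) * Z $$ (m, l))"
      by (rule sum.swap)
    also have "\<dots> = (\<Sum>m<?n. if l = k then - pq_sign p k * pq_sign p m else 0)"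
      using that by (intro sum.cong refl) (simp add: orthonormal_basis_contraction[OF B])
    finally show ?thesis by (simp add: sum_distrib_left)
  qed
  have "tau B (phi p q v a) x = (\<Sum>Z\<in>B. row_form ?n ?w (Z * Z) a)"
    unfolding tau_def by (intro sum.cong refl deriv_along_phi(2)[OF v ac x] BL)
  also have "\<dots> = (\<Sum>k<?n. \<Sum>l<?n. \<Sum>Z\<in>B. ?w k * (Z * Z) $$ (k, l) * a $ l)"
    unfolding row_form_def by (simp only: sum.swap[of _ _ B])
  also have "\<dots> = (\<Sum>k<?n. \<Sum>l<?n. ?w k * (\<Sum>Z\<in>B. (Z * Z) $$ (k, l)) * a $ l)"
    by (simp only: sum_distrib_left sum_distrib_right)
  also have "\<dots> = (\<Sum>k<?n. \<Sum>l<?n. if l = k then ?w k * (- pq_sign p k * ?r) * a $ k else 0)"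
    by (intro sum.cong refl) (simp add: square del: index_mult_mat(1))
  also have "\<dots> = (\<Sum>k<?n. - ?r * (?w k * (pq_sign p k * a $ k)))"
    by (intro sum.cong refl) (simp add: mult_ac)
  also have "\<dots> = (\<Sum>k<?n. - s * ?r * (?w k * a $ k))"
  proof (intro sum.cong refl)
    fix k assume "k \<in> {..<?n}"
    then have "pq_sign p k * a $ k = s * a $ k" by (intro as) simp
    then show "- ?r * (?w k * (pq_sign p k * a $ k)) = - s * ?r * (?w k * a $ k)"
      by (simp only:) (simp only: mult_ac mult_minus_left mult_minus_right)
  qed
  also have "\<dots> = - s * ?r * phi p q v a x"
    by (simp only: phi_eq_translated_row[OF v ac x] sum_distrib_left[symmetric])
  finally show ?thesis .
qed

text \<open>
  The contraction exchanges the column indices of the two factors, so that \<open>w\<^sub>k Z\<^bsub>kl\<^esub> a\<^sub>l\<close>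
  and \<open>w\<^sub>i Z\<^bsub>ij\<^esub> b\<^sub>j\<close> combine to \<open>- (w\<^sub>k e\<^sub>k b\<^sub>k) (w\<^sub>l e\<^sub>l a\<^sub>l)\<close>; the sums over
  \<open>k\<close> and \<open>l\<close> then separate.
\<close>
lemma kappa_phi:
  assumes B: "orthonormal_basis (p + q) (U_pq p q) B" and v: "v \<in> carrier_vec (p + q)"
    and a: "a \<in> sign_eigenspace p q s" and b: "b \<in> sign_eigenspace p q t"
    and x: "x \<in> U_pq p q"
  shows "kappa B (phi p q v a) (phi p q v b) x = - (s * t) * phi p q v a x * phi p q v b x"
proof -
  let ?n = "p + q"
  let ?w = "translated_row ?n v x"
  have BL: "Z \<in> lie_algebra ?n (U_pq p q)" if "Z \<in> B" for Z
    using B that by (auto simp: orthonormal_basis_def)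
  have ac: "a \<in> carrier_vec ?n" and as: "j < ?n \<Longrightarrow> pq_sign p j * a $ j = s * a $ j" for j
    using a by (auto simp: sign_eigenspace_def)
  have bc: "b \<in> carrier_vec ?n" and bt: "j < ?n \<Longrightarrow> pq_sign p j * b $ j = t * b $ j" for j
    using b by (auto simp: sign_eigenspace_def)
  have contract: "(\<Sum>Z\<in>B. Z $$ (k, l) * row_form ?n ?w Z b) =
      - (pq_sign p k * b $ k) * (pq_sign p l * ?w l)" if "k < ?n" "l < ?n" for k l
  proof -
    have "(\<Sum>Z\<in>B. Z $$ (k, l) * row_form ?n ?w Z b) =
        (\<Sum>i<?n. \<Sum>j<?n. \<Sum>Z\<in>B. ?w i * (Z $$ (k, l) * Z $$ (i, j)) * b $ j)"
      unfolding row_form_def sum_distrib_left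
      by (simp only: sum.swap[of _ _ B] mult_ac)
    also have "\<dots> = (\<Sum>i<?n. \<Sum>j<?n. ?w i * (\<Sum>Z\<in>B. Z $$ (k, l) * Z $$ (i, j)) * b $ j)"
      by (simp only: sum_distrib_left sum_distrib_right)
    also have "\<dots> = (\<Sum>i<?n. \<Sum>j<?n. if j = k \<and> i = l then
        - (pq_sign p k * b $ j) * (pq_sign p l * ?w i) else 0)"
      using that by (intro sum.cong refl) (simp add: orthonormal_basis_contraction[OF B] mult_ac)
    also have "\<dots> = (\<Sum>j<?n. \<Sum>i<?n. if j = k \<and> i = l then
        - (pq_sign p k * b $ j) * (pq_sign p l * ?w i) else 0)"
      by (rule sum.swap)
    finally show ?thesis using that by (simp only: sum_sum_delta)
  qed
  have "kappa B (phi p q v a) (phi p q v b) x = (\<Sum>Z\<in>B. row_form ?n ?w Z a * row_form ?n ?w Z b)"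
    unfolding kappa_def
    by (intro sum.cong refl) (simp only: deriv_along_phi(1)[OF v _ x BL] ac bc)
  also have "\<dots> = (\<Sum>Z\<in>B. \<Sum>k<?n. \<Sum>l<?n. ?w k * (Z $$ (k, l) * row_form ?n ?w Z b) * a $ l)"
    unfolding row_form_def[of _ _ _ a] sum_distrib_right by (intro sum.cong refl) (simp only: mult_ac)
  also have "\<dots> = (\<Sum>k<?n. \<Sum>l<?n. \<Sum>Z\<in>B. ?w k * (Z $$ (k, l) * row_form ?n ?w Z b) * a $ l)"
    by (simp only: sum.swap[of _ _ B])
  also have "\<dots> = (\<Sum>k<?n. \<Sum>l<?n. ?w k * (\<Sum>Z\<in>B. Z $$ (k, l) * row_form ?n ?w Z b) * a $ l)"
    by (simp only: sum_distrib_left sum_distrib_right)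
  also have "\<dots> = (\<Sum>k<?n. \<Sum>l<?n. - (s * t) * ((?w k * b $ k) * (?w l * a $ l)))"
  proof (intro sum.cong refl)
    fix k l assume "k \<in> {..<?n}" "l \<in> {..<?n}"
    then have kl: "k < ?n" "l < ?n" by auto
    have "?w k * (\<Sum>Z\<in>B. Z $$ (k, l) * row_form ?n ?w Z b) * a $ l =
        - ((?w k * (pq_sign p k * b $ k)) * (?w l * (pq_sign p l * a $ l)))"
      unfolding contract[OF kl] by (simp add: mult_ac)
    also have "\<dots> = - (s * t) * ((?w k * b $ k) * (?w l * a $ l))"
      unfolding as[OF kl(2)] bt[OF kl(1)] by (simp add: mult_ac)
    finally show "?w k * (\<Sum>Z\<in>B. Z $$ (k, l) * row_form ?n ?w Z b) * a $ l =
        - (s * t) * ((?w k * b $ k) * (?w l * a $ l))" .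
  qed
  also have "\<dots> = - (s * t) * ((\<Sum>k<?n. ?w k * b $ k) * (\<Sum>l<?n. ?w l * a $ l))"
    unfolding sum_product by (simp only: sum_distrib_left)
  also have "\<dots> = - (s * t) * phi p q v a x * phi p q v b x"
    unfolding phi_eq_translated_row[OF v ac x] phi_eq_translated_row[OF v bc x]
    by (simp only: mult_ac)
  finally show ?thesis .
qed

section \<open>The two families\<close>

lemma eigenfamily_phi:
  assumes v: "v \<in> carrier_vec (p + q)"
  shows "eigenfamily (p + q) (U_pq p q) {phi p q v a | a. a \<in> sign_eigenspace p q s}"
proof -
  have "\<forall>\<phi>\<in>{phi p q v a | a. a \<in> sign_eigenspace p q s}.
      twice_differentiable_along (p + q) (U_pq p q) \<phi>"
    using twice_differentiable_along_phi[OF v] by (auto simp: sign_eigenspace_def)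
  then show ?thesis
    unfolding eigenfamily_def using tau_phi[OF _ v] kappa_phi[OF _ v] by blast
qed

lemma function_space_on_phi:
  assumes v: "v \<in> carrier_vec (p + q)"
  shows "function_space_on (U_pq p q) {phi p q v a | a. a \<in> sign_eigenspace p q s}"
    (is "function_space_on ?G ?F")
proof -
  let ?n = "p + q" and ?V = "sign_eigenspace p q s"
  have carr: "a \<in> carrier_vec ?n" if "a \<in> ?V" for a
    using that by (simp add: sign_eigenspace_def)
  have zero: "0\<^sub>v ?n \<in> ?V"
    by (simp add: sign_eigenspace_def)
  have add: "a + b \<in> ?V" if "a \<in> ?V" "b \<in> ?V" for a b
    using that by (fastforce simp: sign_eigenspace_def distrib_left)
  have smult: "c \<cdot>\<^sub>v a \<in> ?V" if "a \<in> ?V" for a c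
    using that by (auto simp: sign_eigenspace_def mult.left_commute)
  have ext: "phi p q v a \<in> extensional ?G" for a
    by (simp add: phi_def)
  have phi_0: "(\<lambda>x\<in>?G. 0) = phi p q v (0\<^sub>v ?n)"
    by (rule extensionalityI[OF _ ext]) (simp_all add: phi_eq_row_form[OF v] row_form_def)
  have phi_add: "(\<lambda>x\<in>?G. phi p q v a x + phi p q v b x) = phi p q v (a + b)"
    if "a \<in> carrier_vec ?n" "b \<in> carrier_vec ?n" for a b
    using that by (intro extensionalityI[OF _ ext])
      (simp_all add: phi_eq_row_form[OF v] row_form_def distrib_left sum.distrib)
  have phi_smult: "(\<lambda>x\<in>?G. c * phi p q v a x) = phi p q v (c \<cdot>\<^sub>v a)"
    if "a \<in> carrier_vec ?n" for a c
    using that by (intro extensionalityI[OF _ ext])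
      (simp_all add: phi_eq_row_form[OF v] row_form_def sum_distrib_left mult_ac)
  show ?thesis
    unfolding function_space_on_def
  proof (intro conjI ballI allI)
    show "?F \<subseteq> extensional ?G" using ext by auto
    show "(\<lambda>x\<in>?G. 0) \<in> ?F" using phi_0 zero by blast
  next
    fix \<phi> \<psi> assume "\<phi> \<in> ?F" "\<psi> \<in> ?F"
    then obtain a b where "a \<in> ?V" "b \<in> ?V" "\<phi> = phi p q v a" "\<psi> = phi p q v b" by auto
    then show "(\<lambda>x\<in>?G. \<phi> x + \<psi> x) \<in> ?F"
      using phi_add[OF carr carr] add by auto
  next
    fix c :: complex and \<phi> assume "\<phi> \<in> ?F"
    then obtain a where "a \<in> ?V" "\<phi> = phi p q v a" by auto
    then show "(\<lambda>x\<in>?G. c * \<phi> x) \<in> ?F"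
      using phi_smult[OF carr] smult by auto
  qed
qed

theorem theorem10p2:
  fixes p q :: nat and v :: "complex vec"
  assumes "p + q > 0"
    and "v \<in> carrier_vec (p + q)" and "v \<noteq> 0\<^sub>v (p + q)"
  shows "function_space_on (U_pq p q) (E1 p q v) \<and> function_space_on (U_pq p q) (E2 p q v) \<and>
    eigenfamily (p + q) (U_pq p q) (E1 p q v) \<and>
    eigenfamily (p + q) (U_pq p q) (E2 p q v) \<and>
    bi_eigenfamily (p + q) (U_pq p q) (E1 p q v) (E2 p q v)"
proof -
  note v = assms(2)
  have E1: "E1 p q v = {phi p q v a | a. a \<in> sign_eigenspace p q (- 1)}"
    and E2: "E2 p q v = {phi p q v a | a. a \<in> sign_eigenspace p q 1}"
    by (simp_all add: E1_def E2_def C1_eq_sign_eigenspace C2_eq_sign_eigenspace)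
  have spaces: "function_space_on (U_pq p q) (E1 p q v)" "function_space_on (U_pq p q) (E2 p q v)"
    unfolding E1 E2 by (rule function_space_on_phi[OF v])+
  have families: "eigenfamily (p + q) (U_pq p q) (E1 p q v)" "eigenfamily (p + q) (U_pq p q) (E2 p q v)"
    unfolding E1 E2 by (rule eigenfamily_phi[OF v])+
  have "E1 p q v \<noteq> {}" "E2 p q v \<noteq> {}"
    using spaces by (auto simp: function_space_on_def)
  moreover have "\<forall>B. orthonormal_basis (p + q) (U_pq p q) B \<longrightarrow>
      (\<forall>\<phi>\<in>E1 p q v. \<forall>\<psi>\<in>E2 p q v. \<forall>x\<in>U_pq p q. kappa B \<phi> \<psi> x = - (- 1 * 1) * \<phi> x * \<psi> x)"
    unfolding E1 E2 using kappa_phi[OF _ v] by blast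
  ultimately have "bi_eigenfamily (p + q) (U_pq p q) (E1 p q v) (E2 p q v)"
    unfolding bi_eigenfamily_def using families by blast
  with spaces families show ?thesis by blast
qed

end
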